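(* Suppose that one of the following four cases holds: (i) $d_1>d_2\ge2$; (ii) $d_1>d_2=1$; (iii) $d_2\ge d_1>1$; (iv) $d_1=d_2=1$. Then there exists $N>0$ such that for every $a\in\mathbb{R}$ with $|a|>N$ and $a h(x)>0$ for all $x\in[0,b]$, there exists an invariant Cantor set $\Lambda_a$ for $f_a$ such that $f_a$ is hyperbolic on $\Lambda_a$ and $f_a:\Lambda_a\to\Lambda_a$ is topologically conjugate to $\sigma:\Sigma_2\to\Sigma_2$. Moreover, in Cases (i)–(iii), every point $x\in(0,b)\setminus\Lambda_a$ either escapes from $[0,b]$ under the iteration of $f_a$ (that is, $f_a^k(x)\notin[0,b]$ for some $k\ge1$) or goes to the fixed point $0$ under the iteration of $f_a$ (that is, $f_a^k(x)\to0$ as $k\to\infty$); in Case (iv), $\Lambda_a=\{x\in\mathbb{R}:\ f_a^k(x)\in[0,b]\ \text{for all}\ k\ge0\}$.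
   Context: Let $g$ be a monic real-coefficient polynomial having $0$ as a zero of multiplicity $d_1\ge1$, and having at least one positive real zero; let $b>0$ be the smallest positive real zero of $g$, with multiplicity $d_2\ge1$. Write $g(x)=x^{d_1}(b-x)^{d_2}h(x)$, where $h$ is a real polynomial with no zeros in $[0,b]$. For a real parameter $a$ let $f_a(x)=a g(x)=a x^{d_1}(b-x)^{d_2}h(x)$; the parameter is assumed to satisfy $a h(x)>0$ for all $x\in[0,b]$. $f_a^k$ denotes the $k$-fold iterate of $f_a$. A set $\Lambda$ is invariant for $f$ if $f(\Lambda)=\Lambda$. For a $C^1$ map $f:\mathbb{R}\to\mathbb{R}$, a compact invariant set $\Lambda$ is a hyperbolic set for $f$ (equivalently, $f$ is hyperbolic on $\Lambda$) if there are constants $C>0$ and $\lambda>1$ such that $|(f^n)'(x)|\ge C\lambda^n$ for all $x\in\Lambda$ and all $n\ge1$. $\Sigma_2=\{(s_0,s_1,s_2,\dots): s_i\in\{1,2\}\}$ is the one-sided sequence space on two symbols with the metric $d(s,t)=\sum_{i\ge0}\delta(s_i,t_i)/2^i$ ($\delta(s_i,t_i)=1$ if $s_i\ne t_i$ and $0$ otherwise), and $\sigma(s_0,s_1,s_2,\dots)=(s_1,s_2,\dots)$ is the shift map. *)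

theory Defs
  imports "HOL-Analysis.Analysis" "HOL-Computational_Algebra.Polynomial"
begin

definition poly_family :: "real poly \<Rightarrow> real \<Rightarrow> real \<Rightarrow> real" where
  "poly_family g a = (\<lambda>x. a * poly g x)"

definition invariant_set :: "('a \<Rightarrow> 'a) \<Rightarrow> 'a set \<Rightarrow> bool" where
  "invariant_set f S \<longleftrightarrow> f ` S = S"

text \<open>The last two conjuncts say that the set is perfect (being closed, it only has to have no
  isolated points) and totally disconnected.\<close>

definition cantor_set :: "'a::topological_space set \<Rightarrow> bool" where
  "cantor_set S \<longleftrightarrow> S \<noteq> {} \<and> compact S \<and> (\<forall>x\<in>S. x islimpt S) \<and>
     (\<forall>x\<in>S. connected_component_set S x = {x})"

definition hyperbolic_on :: "(real \<Rightarrow> real) \<Rightarrow> real set \<Rightarrow> bool" where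
  "hyperbolic_on f S \<longleftrightarrow> f C1_differentiable_on UNIV \<and> compact S \<and> invariant_set f S \<and>
     (\<exists>C>0. \<exists>l>1. \<forall>x\<in>S. \<forall>n\<ge>1. \<bar>deriv (f ^^ n) x\<bar> \<ge> C * l ^ n)"

definition top_conjugate :: "'a topology \<Rightarrow> ('a \<Rightarrow> 'a) \<Rightarrow> 'b topology \<Rightarrow> ('b \<Rightarrow> 'b) \<Rightarrow> bool" where
  "top_conjugate X f Y g \<longleftrightarrow> continuous_map X X f \<and> continuous_map Y Y g \<and>
     (\<exists>\<phi>. homeomorphic_map X Y \<phi> \<and> (\<forall>x\<in>topspace X. \<phi> (f x) = g (\<phi> x)))"

definition Sigma2 :: "(nat \<Rightarrow> nat) set" where
  "Sigma2 = {s. \<forall>i. s i \<in> {1, 2}}"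

definition seq_dist :: "(nat \<Rightarrow> nat) \<Rightarrow> (nat \<Rightarrow> nat) \<Rightarrow> real" where
  "seq_dist s t = (\<Sum>i. (if s i \<noteq> t i then 1 else 0) / 2 ^ i)"

definition shift :: "(nat \<Rightarrow> nat) \<Rightarrow> nat \<Rightarrow> nat" where
  "shift s = (\<lambda>i. s (Suc i))"

lemma summable_seq_dist: "summable (\<lambda>i. (if s i \<noteq> t i then 1 else 0) / 2 ^ i :: real)"
proof (rule summable_comparison_test'[where N = 0])
  show "summable (\<lambda>i. (1/2) ^ i :: real)"
    by (simp add: summable_geometric)
qed (simp add: power_one_over)

interpretation Sigma2: Metric_space Sigma2 seq_dist
proof
  fix x y :: "nat \<Rightarrow> nat"
  show "0 \<le> seq_dist x y"
    unfolding seq_dist_def by (intro suminf_nonneg summable_seq_dist) auto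
  show "seq_dist x y = seq_dist y x"
    unfolding seq_dist_def by (simp add: eq_commute)
  have "seq_dist x y = 0 \<longleftrightarrow> (\<forall>i. (if x i \<noteq> y i then 1 else 0) / 2 ^ i = (0::real))"
    unfolding seq_dist_def by (intro suminf_eq_zero_iff summable_seq_dist) auto
  then show "seq_dist x y = 0 \<longleftrightarrow> x = y"
    by (auto simp: fun_eq_iff split: if_splits)
  fix z :: "nat \<Rightarrow> nat"
  have "seq_dist x z \<le> (\<Sum>i. (if x i \<noteq> y i then 1 else 0) / 2 ^ i + (if y i \<noteq> z i then 1 else 0) / 2 ^ i)"
    unfolding seq_dist_def
    by (intro suminf_le summable_add summable_seq_dist) (auto simp: field_simps)
  also have "\<dots> = seq_dist x y + seq_dist y z"
    unfolding seq_dist_def by (intro suminf_add[symmetric] summable_seq_dist)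
  finally show "seq_dist x z \<le> seq_dist x y + seq_dist y z" .
qed

abbreviation Sigma2_top :: "(nat \<Rightarrow> nat) topology" where
  "Sigma2_top \<equiv> Metric_space.mtopology Sigma2 seq_dist"

end

theory Submission
  imports Defs
begin

text \<open>
  For \<open>|a|\<close> large the graph of \<open>f = f\<^sub>a\<close> over \<open>[0,b]\<close> is a tall hump: \<open>f\<close> exceeds \<open>b\<close> except close to
  the two end points, where it is monotone. Orbits that stay in the interval therefore use only two
  full monotone branches, and the set of such orbits is coded by the branch visited at each time.

  What makes the coding a conjugacy, and the set hyperbolic, is expansion. If \<open>d\<^sub>1 = d\<^sub>2 = 1\<close>, then
  \<open>f'\<close> itself is large on both branches. If \<open>d\<^sub>1 \<ge> 2\<close>, it is not: \<open>0\<close> is superattracting, and when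
  \<open>d\<^sub>2 \<ge> d\<^sub>1\<close> the slope near the right end of the horseshoe may even be small. The horseshoe is then
  cut down to \<open>[z,w]\<close>, where \<open>z\<close> is the repelling fixed point bounding the immediate basin of \<open>0\<close> and
  \<open>w\<close> is its preimage near \<open>b\<close>, and lengths are measured by \<open>dx/x\<close>. In this metric the derivative is
  \<open>x f'(x)/f(x)\<close>, which does not depend on \<open>a\<close>, tends to \<open>d\<^sub>1 \<ge> 2\<close> at \<open>0\<close> and to \<open>-\<infinity>\<close> at \<open>b\<close>; so it
  has absolute value at least \<open>3/2\<close> on both branches. As the weight \<open>1/x\<close> is bounded above and below
  on \<open>[z,w]\<close>, uniform expansion in the weighted metric gives hyperbolicity in the ordinary one.
  This treats all multiplicities with \<open>d\<^sub>1 \<ge> 2\<close> at once, without comparing \<open>d\<^sub>1\<close> with \<open>d\<^sub>2\<close>.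

  The locale \<open>horseshoe_map\<close> collects what a map needs for this, with an arbitrary weight;
  its main result is \<open>horseshoe_survivors\<close>. The lemmas \<open>horseshoe_simple_ends\<close> and
  \<open>horseshoe_superattracting\<close> instantiate it, the latter also following the remaining orbits: one
  that stays in \<open>[0,b]\<close> but leaves \<open>[z,w]\<close> falls into the basin \<open>[0,z)\<close>. The locale \<open>two_zero_poly\<close>
  supplies the estimates for the polynomials.
\<close>

section \<open>Sequence space\<close>

lemma seq_dist_le_of_agree:
  assumes "\<And>i. i < n \<Longrightarrow> s i = t i"
  shows "seq_dist s t \<le> 2 * (1/2) ^ n"
proof -
  let ?u = "\<lambda>i. (if s i \<noteq> t i then 1 else 0) / 2 ^ i :: real"
  have "seq_dist s t = (\<Sum>i. ?u (i + n)) + (\<Sum>i<n. ?u i)"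
    unfolding seq_dist_def by (rule suminf_split_initial_segment[OF summable_seq_dist])
  also have "(\<Sum>i<n. ?u i) = 0"
    using assms by (intro sum.neutral) auto
  also have "(\<Sum>i. ?u (i + n)) \<le> (\<Sum>i. (1/2) ^ n * (1/2) ^ i)"
  proof (intro suminf_le allI)
    show "summable (\<lambda>i. ?u (i + n))"
      by (rule summable_ignore_initial_segment[OF summable_seq_dist])
    show "summable (\<lambda>i. (1/2) ^ n * (1/2) ^ i :: real)"
      by (intro summable_mult summable_geometric) simp
  qed (auto simp: power_add field_simps)
  also have "\<dots> = 2 * (1/2) ^ n"
    using suminf_geometric[of "1/2::real"] suminf_mult[of "\<lambda>i. (1/2::real)^i" "(1/2)^n"]
    by (simp add: summable_geometric)
  finally show ?thesis by simp
qed

section \<open>Horseshoes of interval maps\<close>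

definition is_horseshoe :: "(real \<Rightarrow> real) \<Rightarrow> real set \<Rightarrow> bool" where
  "is_horseshoe f L \<longleftrightarrow> invariant_set f L \<and> cantor_set L \<and> hyperbolic_on f L \<and>
     top_conjugate (top_of_set L) f Sigma2_top shift"

text \<open>The interval \<open>{lo..hi}\<close> is mapped over itself once by each of \<open>{lo..c}\<close> and \<open>{d..hi}\<close>; these may
  be longer than the actual preimages, which spares computing where \<open>f\<close> takes the value \<open>hi\<close>. The
  weight \<open>w\<close> is the density of a metric \<open>w(x) dx\<close> that \<open>f\<close> expands by the factor \<open>\<kappa>\<close>.\<close>
locale horseshoe_map =
  fixes f f' w :: "real \<Rightarrow> real" and lo hi c d \<kappa> m M :: real
  assumes has_deriv: "\<And>x. (f has_real_derivative f' x) (at x)"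
    and cont_deriv: "continuous_on UNIV f'"
    and order: "lo < c" "c < d" "d < hi"
    and ends: "f lo = lo" "f hi = lo"
    and left_mono: "mono_on {lo..c} f"
    and right_mono: "antimono_on {d..hi} f"
    and gap: "\<And>x. x \<in> {c..d} \<Longrightarrow> hi < f x"
    and expansion_factor: "1 < \<kappa>"
    and weight_bounds: "0 < m" "\<And>x. x \<in> {lo..hi} \<Longrightarrow> m \<le> w x \<and> w x \<le> M"
    and expansion: "\<And>x. x \<in> {lo..c} \<union> {d..hi} \<Longrightarrow> f x \<in> {lo..hi} \<Longrightarrow>
           \<kappa> * w x \<le> \<bar>f' x\<bar> * w (f x)"
begin

definition survivors :: "real set" where
  "survivors = {x. \<forall>k. (f ^^ k) x \<in> {lo..hi}}"

definition branch :: "nat \<Rightarrow> real set" where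
  "branch s = (if s = 1 then {lo..c} else {d..hi})"

definition itinerary :: "real \<Rightarrow> nat \<Rightarrow> nat" where
  "itinerary x k = (if (f ^^ k) x < c then 1 else 2)"

definition cylinder :: "(nat \<Rightarrow> nat) \<Rightarrow> nat \<Rightarrow> real set" where
  "cylinder s n = {x. (\<forall>k<n. (f ^^ k) x \<in> branch (s k)) \<and> (\<forall>k\<le>n. (f ^^ k) x \<in> {lo..hi})}"

lemma continuous_f: "continuous_on S f"
  using has_deriv by (meson DERIV_isCont continuous_at_imp_continuous_on)

lemma continuous_iterate: "continuous_on S (f ^^ k)"
proof (induction k)
  case (Suc k)
  then show ?case
    using continuous_on_compose[OF Suc continuous_f] by (simp add: o_def)
qed (simp add: id_def)

lemma iterate_Suc: "(f ^^ Suc k) x = (f ^^ k) (f x)"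
  by (simp add: funpow_Suc_right del: funpow.simps)

lemma survivorsD: "x \<in> survivors \<Longrightarrow> (f ^^ k) x \<in> {lo..hi}"
  by (simp add: survivors_def)

lemma survivor_iff: "x \<in> survivors \<longleftrightarrow> x \<in> {lo..hi} \<and> f x \<in> survivors"
proof
  assume x: "x \<in> survivors"
  have "(f ^^ k) (f x) \<in> {lo..hi}" for k
    using survivorsD[OF x, of "Suc k"] by (simp only: iterate_Suc)
  then show "x \<in> {lo..hi} \<and> f x \<in> survivors"
    using survivorsD[OF x, of 0] by (simp add: survivors_def)
next
  assume x: "x \<in> {lo..hi} \<and> f x \<in> survivors"
  have "(f ^^ k) x \<in> {lo..hi}" for k
  proof (cases k)
    case (Suc j)
    then show ?thesis
      using x survivorsD[of "f x" j] by (simp only: iterate_Suc)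
  qed (use x in simp)
  then show "x \<in> survivors" by (simp add: survivors_def)
qed

text \<open>The gap forces an orbit that stays in the interval to stay in the two branches.\<close>
lemma survivor_in_branch:
  assumes "x \<in> survivors"
  shows "(f ^^ k) x \<in> branch (itinerary x k)"
proof -
  have y: "(f ^^ k) x \<in> {lo..hi}" "f ((f ^^ k) x) \<in> {lo..hi}"
    using survivorsD[OF assms, of k] survivorsD[OF assms, of "Suc k"] by simp_all
  then have "(f ^^ k) x \<notin> {c..d}"
    using gap[of "(f ^^ k) x"] by fastforce
  with y show ?thesis
    using order by (auto simp: branch_def itinerary_def)
qed

lemma survivor_in_cylinder: "x \<in> survivors \<Longrightarrow> x \<in> cylinder (itinerary x) n"
  using survivor_in_branch survivorsD by (simp add: cylinder_def)

text \<open>Each branch runs from the fixed value \<open>lo\<close> to a value above \<open>hi\<close>, so it covers the interval.\<close>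
lemma branch_covers:
  assumes "y \<in> {lo..hi}"
  shows "\<exists>x\<in>branch s. f x = y"
proof (cases "s = 1")
  case True
  have "\<exists>x\<ge>lo. x \<le> c \<and> f x = y"
    by (rule IVT') (use assms ends order gap[of c] continuous_f in auto)
  with True show ?thesis by (auto simp: branch_def)
next
  case False
  have "\<exists>x\<ge>d. x \<le> hi \<and> f x = y"
    by (rule IVT2') (use assms ends order gap[of d] continuous_f in auto)
  with False show ?thesis by (auto simp: branch_def)
qed

lemma branch_subset: "branch s \<subseteq> {lo..hi}"
  using order by (auto simp: branch_def)

lemma cylinder_nonempty: "cylinder s n \<noteq> {}"
proof (induction n arbitrary: s)
  case 0
  show ?case using order by (auto simp: cylinder_def intro!: exI[of _ lo])
next
  case (Suc n)
  obtain y where y: "y \<in> cylinder (shift s) n"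
    using Suc by blast
  then have "y \<in> {lo..hi}"
    by (force simp: cylinder_def)
  then obtain x where x: "x \<in> branch (s 0)" "f x = y"
    using branch_covers by blast
  have "(f ^^ k) x \<in> branch (s k)" if "k < Suc n" for k
    using x y that by (cases k) (auto simp: cylinder_def shift_def iterate_Suc simp del: funpow.simps(2))
  moreover have "(f ^^ k) x \<in> {lo..hi}" if "k \<le> Suc n" for k
    using x y that branch_subset[of "s 0"]
    by (cases k) (auto simp: cylinder_def iterate_Suc simp del: funpow.simps(2))
  ultimately show ?case by (auto simp: cylinder_def)
qed

lemma closed_branch: "closed (branch s)"
  by (simp add: branch_def)

lemma closed_vimage_iterate: "closed S \<Longrightarrow> closed ((f ^^ k) -` S)"
  by (rule closed_vimage[OF _ continuous_iterate])

lemma compact_cylinder: "compact (cylinder s n)"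
proof -
  have "cylinder s n = {lo..hi} \<inter> ((\<Inter>k\<in>{..<n}. (f ^^ k) -` branch (s k)) \<inter>
      (\<Inter>k\<in>{..n}. (f ^^ k) -` {lo..hi}))"
    by (force simp: cylinder_def)
  moreover note closed_vimage_iterate
  ultimately show ?thesis
    using closed_branch by (simp add: compact_Int_closed closed_Int closed_INT)
qed

text \<open>The cylinders of \<open>s\<close> are nonempty nested compact sets; a common point has itinerary \<open>s\<close>.\<close>
lemma itinerary_realised:
  assumes "s \<in> Sigma2"
  shows "\<exists>x\<in>survivors. itinerary x = s"
proof -
  have "\<Inter>(range (cylinder s)) \<noteq> {}"
    by (rule compact_nest[OF compact_cylinder cylinder_nonempty]) (auto simp: cylinder_def)
  then obtain x where x: "\<And>n. x \<in> cylinder s n" by blast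
  have "x \<in> survivors"
    using x by (force simp: survivors_def cylinder_def)
  moreover have "itinerary x k = s k" for k
  proof -
    have "(f ^^ k) x \<in> branch (s k)"
      using x[of "Suc k"] by (auto simp: cylinder_def)
    moreover have "(f ^^ k) x \<noteq> c"
      using gap[of c] order survivorsD[OF \<open>x \<in> survivors\<close>, of "Suc k"] by auto
    moreover have "s k \<in> {1,2}"
      using assms by (auto simp: Sigma2_def)
    ultimately show ?thesis
      using order by (auto simp: branch_def itinerary_def split: if_splits)
  qed
  ultimately show ?thesis by blast
qed

lemma deriv_iterate:
  "(f ^^ n has_real_derivative (\<Prod>k<n. f' ((f ^^ k) x))) (at x)"
proof (induction n)
  case 0
  then show ?case by (simp add: id_def)
next
  case (Suc n)
  show ?case
    using DERIV_chain[OF has_deriv[of "(f ^^ n) x"] Suc] by (simp add: mult.commute o_def)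
qed

text \<open>The chain rule in the weighted metric: the intermediate weights telescope.\<close>
lemma deriv_iterate_weighted:
  assumes "x \<in> cylinder s n"
  shows "\<kappa> ^ n * w x \<le> \<bar>\<Prod>k<n. f' ((f ^^ k) x)\<bar> * w ((f ^^ n) x)"
  using assms
proof (induction n)
  case (Suc n)
  let ?P = "\<Prod>k<n. f' ((f ^^ k) x)" and ?y = "(f ^^ n) x"
  have "x \<in> cylinder s n" using Suc.prems by (auto simp: cylinder_def)
  then have IH: "\<kappa> ^ n * w x \<le> \<bar>?P\<bar> * w ?y" by (rule Suc.IH)
  have "?y \<in> branch (s n)" "f ?y \<in> {lo..hi}"
    using Suc.prems by (auto simp: cylinder_def dest: spec[of _ "Suc n"])
  then have "\<kappa> * w ?y \<le> \<bar>f' ?y\<bar> * w (f ?y)"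
    by (intro expansion) (auto simp: branch_def split: if_splits)
  then have "\<bar>?P\<bar> * (\<kappa> * w ?y) \<le> \<bar>?P\<bar> * (\<bar>f' ?y\<bar> * w (f ?y))"
    by (intro mult_left_mono) auto
  moreover have "\<kappa> * (\<kappa> ^ n * w x) \<le> \<kappa> * (\<bar>?P\<bar> * w ?y)"
    using IH expansion_factor by (intro mult_left_mono) auto
  ultimately show ?case
    by (simp add: abs_mult algebra_simps)
qed simp

lemma weight_ratio_pos: "0 < m / M"
  using weight_bounds(1) weight_bounds(2)[of lo] order by simp

lemma deriv_iterate_ge:
  assumes "x \<in> cylinder s n"
  shows "m / M * \<kappa> ^ n \<le> \<bar>\<Prod>k<n. f' ((f ^^ k) x)\<bar>"
proof -
  let ?P = "\<bar>\<Prod>k<n. f' ((f ^^ k) x)\<bar>"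
  have x: "x \<in> {lo..hi}" and y: "(f ^^ n) x \<in> {lo..hi}"
    using assms by (force simp: cylinder_def)+
  have "m * \<kappa> ^ n \<le> \<kappa> ^ n * w x"
    using weight_bounds(2)[OF x] expansion_factor by (simp add: mult.commute)
  also have "\<dots> \<le> ?P * w ((f ^^ n) x)"
    by (rule deriv_iterate_weighted[OF assms])
  also have "\<dots> \<le> ?P * M"
    using weight_bounds(2)[OF y] by (intro mult_left_mono) auto
  finally show ?thesis
    using weight_ratio_pos weight_bounds(1) by (simp add: field_simps zero_less_divide_iff)
qed

text \<open>A branch is an interval on which \<open>f\<close> is monotone, so betweenness is preserved as long as two orbits
  share their branches. This makes the mean value theorem applicable inside a cylinder.\<close>
lemma cylinder_convex:
  assumes "x \<in> cylinder s n" "y \<in> cylinder s n" "x \<le> t" "t \<le> y"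
  shows "t \<in> cylinder s n"
proof -
  let ?between = "\<lambda>k. (f ^^ k) t \<in> closed_segment ((f ^^ k) x) ((f ^^ k) y)"
  have seg: "?between k" if "k \<le> n" for k
    using that
  proof (induction k)
    case 0
    then show ?case using assms by (simp add: closed_segment_eq_real_ivl)
  next
    case (Suc k)
    let ?x = "(f ^^ k) x" and ?y = "(f ^^ k) y" and ?t = "(f ^^ k) t"
    have b: "?x \<in> branch (s k)" "?y \<in> branch (s k)"
      using Suc.prems assms by (auto simp: cylinder_def)
    have t: "?t \<in> closed_segment ?x ?y" using Suc by simp
    with b have bt: "?t \<in> branch (s k)"
      by (auto simp: branch_def closed_segment_eq_real_ivl split: if_splits)
    have "mono_on (branch (s k)) f \<or> antimono_on (branch (s k)) f"
      using left_mono right_mono by (simp add: branch_def)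
    then show ?case
    proof
      assume "mono_on (branch (s k)) f"
      note mono = monotone_onD[OF this]
      show ?thesis
        using t mono[OF b(1) bt] mono[OF bt b(2)] mono[OF b(2) bt] mono[OF bt b(1)]
        by (auto simp: closed_segment_eq_real_ivl split: if_splits)
    next
      assume "antimono_on (branch (s k)) f"
      note mono = monotone_onD[OF this]
      show ?thesis
        using t mono[OF b(1) bt] mono[OF bt b(2)] mono[OF b(2) bt] mono[OF bt b(1)]
        by (auto simp: closed_segment_eq_real_ivl split: if_splits)
    qed
  qed
  have "(f ^^ k) t \<in> branch (s k)" if "k < n" for k
  proof -
    have "(f ^^ k) x \<in> branch (s k)" "(f ^^ k) y \<in> branch (s k)"
      using that assms by (auto simp: cylinder_def)
    then show ?thesis
      using seg[of k] that by (auto simp: branch_def closed_segment_eq_real_ivl split: if_splits)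
  qed
  moreover have "(f ^^ k) t \<in> {lo..hi}" if "k \<le> n" for k
  proof -
    have "(f ^^ k) x \<in> {lo..hi}" "(f ^^ k) y \<in> {lo..hi}"
      using that assms by (auto simp: cylinder_def)
    then show ?thesis
      using seg[of k] that by (auto simp: closed_segment_eq_real_ivl split: if_splits)
  qed
  ultimately show ?thesis by (auto simp: cylinder_def)
qed

text \<open>The \<open>n\<close>-th iterate stretches a cylinder of order \<open>n\<close> by at least a multiple of \<open>\<kappa> ^ n\<close>, but its
  image still fits into \<open>{lo..hi}\<close>.\<close>
lemma cylinder_small_aux:
  assumes "x \<in> cylinder s n" "y \<in> cylinder s n" "x < y"
  shows "y - x \<le> (hi - lo) * (M / m) * (1 / \<kappa>) ^ n"
proof -
  let ?D = "\<lambda>x. \<Prod>k<n. f' ((f ^^ k) x)"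
  have "\<exists>t>x. t < y \<and> (f ^^ n) y - (f ^^ n) x = (y - x) * ?D t"
    by (rule MVT2[OF \<open>x < y\<close> deriv_iterate])
  then obtain t where t: "x < t" "t < y" "(f ^^ n) y - (f ^^ n) x = (y - x) * ?D t"
    by (elim exE conjE)
  have "t \<in> cylinder s n"
    using cylinder_convex[OF assms(1,2)] t by simp
  then have "m / M * \<kappa> ^ n * (y - x) \<le> \<bar>?D t\<bar> * (y - x)"
    using deriv_iterate_ge \<open>x < y\<close> by (intro mult_right_mono) auto
  also have "\<dots> = \<bar>(f ^^ n) y - (f ^^ n) x\<bar>"
    using t \<open>x < y\<close> by (simp add: abs_mult)
  also have "\<dots> \<le> hi - lo"
  proof -
    have "(f ^^ n) x \<in> {lo..hi}" "(f ^^ n) y \<in> {lo..hi}"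
      using assms by (auto simp: cylinder_def)
    then show ?thesis by auto
  qed
  finally have "m / M * \<kappa> ^ n * (y - x) \<le> hi - lo" .
  then show ?thesis
    using weight_ratio_pos weight_bounds(1) expansion_factor
    by (simp add: field_simps zero_less_divide_iff)
qed

lemma cylinder_small:
  assumes "x \<in> cylinder s n" "y \<in> cylinder s n"
  shows "\<bar>y - x\<bar> \<le> (hi - lo) * (M / m) * (1 / \<kappa>) ^ n"
proof (cases x y rule: linorder_cases)
  case equal
  then show ?thesis
    using weight_ratio_pos weight_bounds(1) expansion_factor order
    by (simp add: zero_less_divide_iff)
next
  case less
  then show ?thesis using cylinder_small_aux[OF assms] by simp
next
  case greater
  then show ?thesis using cylinder_small_aux[OF assms(2,1)] by simp
qed

lemma cylinder_size_tendsto_0: "(\<lambda>n. (hi - lo) * (M / m) * (1 / \<kappa>) ^ n) \<longlonglongrightarrow> 0"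
  using expansion_factor by (intro tendsto_mult_right_zero LIMSEQ_power_zero) auto

lemma eq_if_in_same_cylinders:
  assumes "\<And>n. x \<in> cylinder s n" "\<And>n. y \<in> cylinder s n"
  shows "x = y"
proof -
  have "\<bar>y - x\<bar> \<le> 0"
    by (rule LIMSEQ_le_const[OF cylinder_size_tendsto_0]) (use cylinder_small assms in blast)
  then show ?thesis by simp
qed

lemma inj_itinerary: "inj_on itinerary survivors"
proof (rule inj_onI)
  fix x y assume "x \<in> survivors" "y \<in> survivors" "itinerary x = itinerary y"
  then show "x = y"
    using survivor_in_cylinder[of x] survivor_in_cylinder[of y]
    by (intro eq_if_in_same_cylinders[of x "itinerary x" y]) simp_all
qed

lemma itinerary_in_Sigma2: "itinerary x \<in> Sigma2"
  by (auto simp: Sigma2_def itinerary_def)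

lemma itinerary_shift: "itinerary (f x) = shift (itinerary x)"
  by (simp add: fun_eq_iff itinerary_def shift_def iterate_Suc del: funpow.simps(2))

lemma compact_survivors: "compact survivors"
proof -
  have "survivors = {lo..hi} \<inter> (\<Inter>k. (f ^^ k) -` {lo..hi})"
    by (auto simp: survivors_def dest: spec[of _ 0])
  then show ?thesis
    by (simp add: compact_Int_closed closed_INT closed_vimage_iterate)
qed

lemma invariant_survivors: "invariant_set f survivors"
  unfolding invariant_set_def
proof
  show "f ` survivors \<subseteq> survivors"
    using survivor_iff by blast
  show "survivors \<subseteq> f ` survivors"
  proof
    fix y assume y: "y \<in> survivors"
    then obtain x where "x \<in> branch 1" "f x = y"
      using branch_covers survivorsD[OF y, of 0] by auto
    then show "y \<in> f ` survivors"
      using y survivor_iff branch_subset[of 1] by blast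
  qed
qed

text \<open>Finitely many symbols of the itinerary are locally constant, because the orbit keeps away from the
  gap \<open>{c..d}\<close>; and finitely many symbols determine a sequence up to a small distance.\<close>
lemma continuous_itinerary: "continuous_map (top_of_set survivors) Sigma2_top itinerary"
  unfolding Sigma2.continuous_map_to_metric
proof (intro ballI allI impI)
  fix x e :: real
  assume "x \<in> topspace (top_of_set survivors)" and e: "0 < e"
  then have x: "x \<in> survivors" by simp
  obtain n where n: "(1/2) ^ n < e / 2"
    using real_arch_pow_inv[of "e/2" "1/2"] e by auto
  \<comment> \<open>Any threshold inside the gap separates the branches; the midpoint makes \<open>V k\<close> open on both sides.\<close>
  define V where "V k = (if (f ^^ k) x < c then {y. (f ^^ k) y < c} else {y. (c + d) / 2 < (f ^^ k) y})" for k
  have "open (V k)" for k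
    by (cases "(f ^^ k) x < c")
      (simp_all add: V_def open_Collect_less continuous_iterate del: less_divide_eq_numeral1 divide_less_eq_numeral1)
  then have nbhd: "openin (top_of_set survivors) (survivors \<inter> (\<Inter>k\<in>{..<n}. V k))"
    by (intro openin_open_Int open_INT) auto
  have inV: "x \<in> V k" for k
    using survivor_in_branch[OF x, of k] order
    by (auto simp: V_def itinerary_def branch_def split: if_splits)
  then have mem: "x \<in> survivors \<inter> (\<Inter>k\<in>{..<n}. V k)"
    using x by (intro IntI INT_I)
  have close: "itinerary y \<in> Sigma2.mball (itinerary x) e"
    if "y \<in> survivors \<inter> (\<Inter>k\<in>{..<n}. V k)" for y
  proof -
    have "itinerary x i = itinerary y i" if "i < n" for i
    proof -
      have "y \<in> V i" using \<open>y \<in> _\<close> that by blast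
      then show ?thesis
        using order by (auto simp: V_def itinerary_def split: if_splits)
    qed
    then show ?thesis
      using seq_dist_le_of_agree[of n "itinerary x" "itinerary y"] n
      by (simp add: itinerary_in_Sigma2)
  qed
  show "\<exists>U. openin (top_of_set survivors) U \<and> x \<in> U \<and>
      (\<forall>y\<in>U. itinerary y \<in> Sigma2.mball (itinerary x) e)"
    using nbhd mem close by (intro exI[of _ "survivors \<inter> (\<Inter>k\<in>{..<n}. V k)"] conjI ballI)
qed

lemma homeomorphic_itinerary: "homeomorphic_map (top_of_set survivors) Sigma2_top itinerary"
proof (rule continuous_imp_homeomorphic_map)
  show "itinerary ` topspace (top_of_set survivors) = topspace Sigma2_top"
    using itinerary_realised itinerary_in_Sigma2 by (fastforce simp: image_iff)
  show "compact_space (top_of_set survivors)"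
    using compact_survivors by (simp add: compact_space_subtopology)
  show "inj_on itinerary (topspace (top_of_set survivors))"
    using inj_itinerary by simp
qed (rule continuous_itinerary Sigma2.Hausdorff_space_mtopology)+

text \<open>Continuity of the shift is inherited from \<open>f\<close> through the homeomorphism.\<close>
lemma conjugate_shift: "top_conjugate (top_of_set survivors) f Sigma2_top shift"
proof -
  let ?X = "top_of_set survivors"
  have cont: "continuous_map ?X ?X f"
    using continuous_f invariant_survivors by (auto simp: invariant_set_def)
  obtain g where g: "homeomorphic_maps ?X Sigma2_top itinerary g"
    using homeomorphic_itinerary homeomorphic_map_maps by blast
  have "continuous_map Sigma2_top Sigma2_top (itinerary \<circ> (f \<circ> g))"
    using g cont unfolding homeomorphic_maps_def by (intro continuous_map_compose) auto
  moreover have "(itinerary \<circ> (f \<circ> g)) s = shift s" if "s \<in> topspace Sigma2_top" for s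
    using g that by (simp add: itinerary_shift homeomorphic_maps_def)
  ultimately have "continuous_map Sigma2_top Sigma2_top shift"
    by (rule continuous_map_eq)
  then show ?thesis
    unfolding top_conjugate_def
    by (intro conjI cont exI[of _ itinerary] homeomorphic_itinerary ballI itinerary_shift)
qed

text \<open>Changing the itinerary at one late position gives a different survivor in the same small cylinder.\<close>
lemma survivor_islimpt:
  assumes x: "x \<in> survivors"
  shows "x islimpt survivors"
  unfolding islimpt_approachable
proof (intro allI impI)
  fix e :: real assume "0 < e"
  then obtain n where n: "(hi - lo) * (M / m) * (1 / \<kappa>) ^ n < e"
    using order_tendstoD(2)[OF cylinder_size_tendsto_0] eventually_happens by force
  \<comment> \<open>The map \<open>k \<mapsto> 3 - k\<close> swaps the symbols 1 and 2.\<close>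
  define s where "s = (itinerary x)(n := 3 - itinerary x n)"
  have "s \<in> Sigma2"
    by (auto simp: s_def Sigma2_def itinerary_def)
  then obtain y where y: "y \<in> survivors" "itinerary y = s"
    using itinerary_realised by blast
  have "s n \<noteq> itinerary x n"
    by (auto simp: s_def itinerary_def)
  then have "y \<noteq> x" using y by auto
  have "y \<in> cylinder (itinerary x) n"
    using survivor_in_cylinder[OF y(1), of n] y(2) by (auto simp: cylinder_def s_def)
  then have "dist y x < e"
    using cylinder_small[OF survivor_in_cylinder[OF x]] n by (fastforce simp: dist_real_def)
  with y \<open>y \<noteq> x\<close> show "\<exists>y\<in>survivors. y \<noteq> x \<and> dist y x < e" by blast
qed

text \<open>Two points of a connected set with different \<open>k\<close>-th symbols would force its \<open>k\<close>-th image, an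
  interval, to contain the gap.\<close>
lemma connected_subset_survivors:
  assumes C: "connected C" "C \<subseteq> survivors" and "x \<in> C" "y \<in> C"
  shows "x = y"
proof -
  have "itinerary x k = itinerary y k" for k
  proof (rule ccontr)
    assume ne: "itinerary x k \<noteq> itinerary y k"
    have conn: "connected ((f ^^ k) ` C)"
      by (intro connected_continuous_image continuous_iterate C)
    have br: "(f ^^ k) z < c \<or> d \<le> (f ^^ k) z" if "z \<in> C" for z
      using survivor_in_branch[of z k] that C by (auto simp: branch_def itinerary_def split: if_splits)
    have "c \<in> (f ^^ k) ` C"
      using ne br[of x] br[of y] assms(3,4) order
        connectedD_interval[OF conn, of "(f ^^ k) x" "(f ^^ k) y" c]
        connectedD_interval[OF conn, of "(f ^^ k) y" "(f ^^ k) x" c]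
      by (auto simp: itinerary_def split: if_splits)
    then show False using br order by force
  qed
  then have "itinerary x = itinerary y" by blast
  then show ?thesis using inj_itinerary assms by (meson inj_onD subsetD)
qed

lemma cantor_survivors: "cantor_set survivors"
  unfolding cantor_set_def
proof (intro conjI ballI)
  have "(\<lambda>_. 1) \<in> Sigma2" by (simp add: Sigma2_def)
  then show "survivors \<noteq> {}" using itinerary_realised by blast
  show "connected_component_set survivors x = {x}" if "x \<in> survivors" for x
  proof -
    have "x \<in> connected_component_set survivors x"
      using that by simp
    then show ?thesis
      using connected_subset_survivors[OF connected_connected_component connected_component_subset]
      by blast
  qed
qed (simp_all add: compact_survivors survivor_islimpt)

lemma hyperbolic_survivors: "hyperbolic_on f survivors"
  unfolding hyperbolic_on_def
proof (intro conjI)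
  show "f C1_differentiable_on UNIV"
    unfolding C1_differentiable_on_def
    using has_deriv cont_deriv by (auto simp: has_real_derivative_iff_has_vector_derivative)
  have "m / M * \<kappa> ^ n \<le> \<bar>deriv (f ^^ n) x\<bar>" if "x \<in> survivors" for x n
    using deriv_iterate_ge[OF survivor_in_cylinder[OF that]] DERIV_imp_deriv[OF deriv_iterate]
    by simp
  then have bound: "\<forall>x\<in>survivors. \<forall>n\<ge>1. m / M * \<kappa> ^ n \<le> \<bar>deriv (f ^^ n) x\<bar>"
    by (intro ballI allI impI)
  show "\<exists>C>0. \<exists>l>1. \<forall>x\<in>survivors. \<forall>n\<ge>1. \<bar>deriv (f ^^ n) x\<bar> \<ge> C * l ^ n"
    by (rule exI[of _ "m / M"], rule conjI[OF weight_ratio_pos],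
        rule exI[of _ \<kappa>], rule conjI[OF expansion_factor], rule bound)
qed (simp_all add: compact_survivors invariant_survivors)

theorem horseshoe_survivors: "is_horseshoe f survivors"
  by (simp add: is_horseshoe_def invariant_survivors cantor_survivors hyperbolic_survivors
      conjugate_shift)

end

section \<open>Horseshoes of unimodal maps vanishing at both end points\<close>

text \<open>When both end slopes are steep, the whole interval \<open>{0..b}\<close> carries the horseshoe and the
  Euclidean metric is already expanded.\<close>
lemma horseshoe_simple_ends:
  fixes f f' :: "real \<Rightarrow> real"
  assumes deriv: "\<And>x. (f has_real_derivative f' x) (at x)" and cont: "continuous_on UNIV f'"
    and zeros: "f 0 = 0" "f b = 0"
    and \<delta>: "0 < \<delta>" "\<delta> < b / 2"
    and middle: "\<And>x. x \<in> {\<delta>..b - \<delta>} \<Longrightarrow> b < f x"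
    and left: "\<And>x. x \<in> {0..\<delta>} \<Longrightarrow> 2 \<le> f' x"
    and right: "\<And>x. x \<in> {b - \<delta>..b} \<Longrightarrow> f' x \<le> - 2"
  shows "is_horseshoe f {x. \<forall>k. (f ^^ k) x \<in> {0..b}}"
proof -
  have incr: "mono_on {0..\<delta>} f"
  proof (rule monotone_onI)
    fix x y assume xy: "x \<in> {0..\<delta>}" "y \<in> {0..\<delta>}" "x \<le> y"
    have "0 \<le> f' t" if "x \<le> t" "t \<le> y" for t
      using left[of t] xy that by simp
    then show "f x \<le> f y"
      using deriv by (intro DERIV_nonneg_imp_nondecreasing[OF \<open>x \<le> y\<close>]) blast
  qed
  have decr: "antimono_on {b - \<delta>..b} f"
  proof (rule monotone_onI)
    fix x y assume xy: "x \<in> {b - \<delta>..b}" "y \<in> {b - \<delta>..b}" "x \<le> y"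
    have "f' t \<le> 0" if "x \<le> t" "t \<le> y" for t
      using right[of t] xy that by simp
    then show "f x \<ge> f y"
      using deriv by (intro DERIV_nonpos_imp_nonincreasing[OF \<open>x \<le> y\<close>]) blast
  qed
  interpret H: horseshoe_map f f' "\<lambda>_. 1" 0 b \<delta> "b - \<delta>" 2 1 1
  proof
    fix x assume "x \<in> {0..\<delta>} \<union> {b - \<delta>..b}" "f x \<in> {0..b}"
    then show "2 * 1 \<le> \<bar>f' x\<bar> * 1"
      using left[of x] right[of x] by auto
  qed (use deriv cont zeros \<delta> middle incr decr in auto)
  show ?thesis
    using H.horseshoe_survivors by (simp add: H.survivors_def)
qed

text \<open>The hypotheses \<open>left\<close> and \<open>right\<close> say that \<open>|x f'(x)/f(x)| \<ge> 3/2\<close>, which is expansion in the metric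
  \<open>dx/x\<close>. As the factor exceeds 1, they also make \<open>f(x)/x\<close> increasing near \<open>0\<close>, so that a single fixed
  point \<open>z\<close> separates the points attracted to \<open>0\<close> from those pushed away.\<close>
lemma horseshoe_superattracting:
  fixes f f' :: "real \<Rightarrow> real"
  assumes deriv: "\<And>x. (f has_real_derivative f' x) (at x)" and cont: "continuous_on UNIV f'"
    and zeros: "f 0 = 0" "f b = 0" and crit: "f' 0 = 0"
    and pos: "\<And>x. x \<in> {0<..<b} \<Longrightarrow> 0 < f x"
    and \<delta>: "0 < \<delta>" "\<delta> < b / 2"
    and middle: "\<And>x. x \<in> {\<delta>..b - \<delta>} \<Longrightarrow> b < f x"
    and left: "\<And>x. x \<in> {0<..\<delta>} \<Longrightarrow> 3/2 * f x \<le> x * f' x"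
    and right: "\<And>x. x \<in> {b - \<delta>..<b} \<Longrightarrow> 3/2 * f x \<le> - (x * f' x)"
  shows "\<exists>L. is_horseshoe f L \<and>
    (\<forall>x\<in>{0<..<b} - L. (\<exists>k\<ge>1. (f ^^ k) x \<notin> {0..b}) \<or> (\<lambda>k. (f ^^ k) x) \<longlonglongrightarrow> 0)"
proof -
  have contf: "continuous_on S f" for S
    using deriv by (meson DERIV_isCont continuous_at_imp_continuous_on)
  have f'_pos: "0 < f' x" if "x \<in> {0<..\<delta>}" for x
  proof -
    have "0 < x * f' x" using left[OF that] pos[of x] that \<delta> by auto
    then show ?thesis using that by (simp add: zero_less_mult_iff)
  qed
  have f'_neg: "f' x < 0" if "x \<in> {b - \<delta>..<b}" for x
  proof -
    have "x * f' x < 0" using right[OF that] pos[of x] that \<delta> by auto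
    then show ?thesis using that \<delta> by (simp add: mult_less_0_iff)
  qed
  have incr: "f x < f y" if "0 \<le> x" "x < y" "y \<le> \<delta>" for x y
  proof (rule DERIV_pos_imp_increasing_open[OF \<open>x < y\<close>])
    fix t assume "x < t" "t < y"
    then have "0 < f' t" using that by (intro f'_pos) auto
    with deriv show "\<exists>D. (f has_real_derivative D) (at t) \<and> 0 < D" by blast
  qed (rule contf)
  have decr: "f y < f x" if "b - \<delta> \<le> x" "x < y" "y \<le> b" for x y
  proof (rule DERIV_neg_imp_decreasing_open[OF \<open>x < y\<close>])
    fix t assume "x < t" "t < y"
    then have "f' t < 0" using that by (intro f'_neg) auto
    with deriv show "\<exists>D. (f has_real_derivative D) (at t) \<and> D < 0" by blast
  qed (rule contf)
  have slope_incr: "f x / x < f y / y" if "0 < x" "x < y" "y \<le> \<delta>" for x y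
  proof (rule DERIV_pos_imp_increasing[OF \<open>x < y\<close>])
    fix t assume t: "x \<le> t" "t \<le> y"
    have "((\<lambda>t. f t / t) has_real_derivative (f' t * t - f t * 1) / (t * t)) (at t)"
      using t that by (intro DERIV_divide deriv DERIV_ident) auto
    moreover have "0 < (f' t * t - f t * 1) / (t * t)"
      using left[of t] pos[of t] t that \<delta> by (auto simp: mult.commute)
    ultimately show "\<exists>D. ((\<lambda>t. f t / t) has_real_derivative D) (at t) \<and> 0 < D" by blast
  qed
  obtain x\<^sub>0 where x0: "0 < x\<^sub>0" "x\<^sub>0 < \<delta>" "f x\<^sub>0 < x\<^sub>0"
  proof -
    have "((\<lambda>x. f x / x) \<longlongrightarrow> 0) (at 0)"
      using deriv[of 0] crit zeros by (simp add: has_field_derivative_iff)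
    then have "((\<lambda>x. f x / x) \<longlongrightarrow> 0) (at_right 0)"
      by (rule tendsto_mono[rotated]) (simp add: at_le)
    then have "\<forall>\<^sub>F x in at_right 0. f x / x < 1"
      by (rule order_tendstoD) simp
    moreover have "\<forall>\<^sub>F x in at_right 0. x \<in> {0<..<\<delta>}"
      using \<delta> by (intro eventually_at_right_real)
    ultimately have "\<forall>\<^sub>F x in at_right (0::real). f x / x < 1 \<and> x \<in> {0<..<\<delta>}"
      by (rule eventually_conj)
    then obtain x where "f x / x < 1 \<and> x \<in> {0<..<\<delta>}"
      using eventually_happens'[OF trivial_limit_at_right_real[of "0::real"]] by blast
    then show ?thesis by (intro that[of x]) (auto simp: divide_less_eq)
  qed
  obtain z where z: "0 < z" "z < \<delta>" "f z = z"
  proof -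
    have "\<exists>z\<ge>x\<^sub>0. z \<le> \<delta> \<and> f z - z = 0"
      using x0 middle[of \<delta>] \<delta> by (intro IVT' continuous_intros contf) auto
    then obtain z where "x\<^sub>0 \<le> z" "z \<le> \<delta>" "f z = z" by auto
    moreover from this have "z \<noteq> \<delta>" using middle[of \<delta>] \<delta> by auto
    ultimately show ?thesis using x0 by (intro that[of z]) auto
  qed
  obtain w where w: "b - \<delta> < w" "w < b" "f w = z"
  proof -
    have "\<exists>w\<ge>b - \<delta>. w \<le> b \<and> f w = z"
      using z zeros middle[of "b - \<delta>"] \<delta> by (intro IVT2' contf) auto
    then obtain w where "b - \<delta> \<le> w" "w \<le> b" "f w = z" by auto
    moreover from this have "w \<noteq> b" "w \<noteq> b - \<delta>"
      using z zeros middle[of "b - \<delta>"] \<delta> by auto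
    ultimately show ?thesis by (intro that[of w]) auto
  qed
  have below: "f x < x" if "0 < x" "x < z" for x
    using slope_incr[of x z] that z by (simp add: divide_less_eq)
  \<comment> \<open>On \<open>[z,w]\<close> the weight \<open>1/x\<close> lies between \<open>1/w\<close> and \<open>1/z\<close>.\<close>
  interpret H: horseshoe_map f f' "\<lambda>x. 1 / x" z w \<delta> "b - \<delta>" "3/2" "1 / w" "1 / z"
  proof
    show "mono_on {z..\<delta>} f"
      using incr z by (intro monotone_onI) (force simp: le_less)
    show "antimono_on {b - \<delta>..w} f"
      using decr w by (intro monotone_onI) (force simp: le_less)
    show "1 / w \<le> 1 / x \<and> 1 / x \<le> 1 / z" if "x \<in> {z..w}" for x
      using that z by (auto intro!: divide_left_mono)
    fix x assume x: "x \<in> {z..\<delta>} \<union> {b - \<delta>..w}" "f x \<in> {z..w}"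
    have "3/2 * f x \<le> x * \<bar>f' x\<bar>"
    proof (cases "x \<le> \<delta>")
      case True
      then show ?thesis using left[of x] f'_pos[of x] x z \<delta> by auto
    next
      case False
      then show ?thesis using right[of x] f'_neg[of x] x w \<delta> by auto
    qed
    then show "3/2 * (1 / x) \<le> \<bar>f' x\<bar> * (1 / f x)"
      using x z \<delta> by (auto simp: field_simps)
  next
    show "w < f x" if "x \<in> {\<delta>..b - \<delta>}" for x
      using middle[OF that] w by simp
  qed (use deriv cont z w \<delta> in auto)
  \<comment> \<open>Orbits below \<open>z\<close> decrease, and their limit is a fixed point below \<open>z\<close>.\<close>
  have basin: "(\<lambda>k. (f ^^ k) y) \<longlonglongrightarrow> 0" if y: "0 \<le> y" "y < z" for y
  proof -
    have step: "0 \<le> f x \<and> f x \<le> x" if "0 \<le> x" "x < z" for x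
      using that below[of x] pos[of x] zeros z \<delta> by (cases "x = 0") auto
    have bounds: "0 \<le> (f ^^ k) y \<and> (f ^^ k) y \<le> y" for k
    proof (induction k)
      case (Suc k)
      then show ?case using step[of "(f ^^ k) y"] y by auto
    qed (use y in simp)
    have "f ((f ^^ k) y) \<le> (f ^^ k) y" for k
      using step[of "(f ^^ k) y"] bounds[of k] y by simp
    then have "decseq (\<lambda>k. (f ^^ k) y)"
      by (intro decseq_SucI) simp
    then obtain l where l: "(\<lambda>k. (f ^^ k) y) \<longlonglongrightarrow> l"
      using decseq_convergent[of _ 0] bounds by blast
    have "0 \<le> l" "l \<le> y"
      using LIMSEQ_le_const[OF l] LIMSEQ_le_const2[OF l] bounds by blast+
    have "isCont f l" using deriv DERIV_isCont by blast
    then have "(\<lambda>k. f ((f ^^ k) y)) \<longlonglongrightarrow> f l"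
      using l isCont_tendsto_compose by blast
    moreover have "(\<lambda>k. f ((f ^^ k) y)) \<longlonglongrightarrow> l"
      using LIMSEQ_Suc[OF l] by simp
    ultimately have "f l = l" by (rule LIMSEQ_unique)
    then have "l = 0"
      using below[of l] \<open>0 \<le> l\<close> \<open>l \<le> y\<close> y by fastforce
    with l show ?thesis by simp
  qed
  have "(\<lambda>k. (f ^^ k) x) \<longlonglongrightarrow> 0"
    if x: "x \<in> {0<..<b}" "x \<notin> H.survivors" and stay: "\<And>k. k \<ge> 1 \<Longrightarrow> (f ^^ k) x \<in> {0..b}" for x
  proof -
    have stay': "(f ^^ k) x \<in> {0..b}" for k
      using x stay[of k] by (cases k) auto
    obtain k where k: "(f ^^ k) x \<notin> {z..w}"
      using x by (auto simp: H.survivors_def)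
    \<comment> \<open>A point of \<open>(w,b]\<close> is mapped below \<open>f(w) = z\<close>, so one more step suffices on that side.\<close>
    have "\<exists>k. 0 \<le> (f ^^ k) x \<and> (f ^^ k) x < z"
    proof (cases "(f ^^ k) x < z")
      case True
      then show ?thesis using stay'[of k] by auto
    next
      case False
      then have "f ((f ^^ k) x) < f w"
        using k stay'[of k] w by (intro decr) auto
      then show ?thesis
        using stay'[of "Suc k"] w by (intro exI[of _ "Suc k"]) auto
    qed
    then obtain j where "0 \<le> (f ^^ j) x" "(f ^^ j) x < z" by blast
    then have "(\<lambda>n. (f ^^ n) ((f ^^ j) x)) \<longlonglongrightarrow> 0" by (rule basin)
    then have "(\<lambda>n. (f ^^ (n + j)) x) \<longlonglongrightarrow> 0" by (simp add: funpow_add)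
    then show ?thesis by (rule LIMSEQ_offset)
  qed
  then have "(\<exists>k\<ge>1. (f ^^ k) x \<notin> {0..b}) \<or> (\<lambda>k. (f ^^ k) x) \<longlonglongrightarrow> 0"
    if "x \<in> {0<..<b} - H.survivors" for x
    using that by blast
  then show ?thesis
    by (intro exI[of _ H.survivors] conjI H.horseshoe_survivors ballI)
qed

section \<open>Polynomials scaled by a large factor\<close>

lemma positive_near_ends:
  fixes F G :: "real \<Rightarrow> real"
  assumes "isCont F 0" "0 < F 0" "isCont G b" "0 < G b" "0 < b"
  obtains \<delta> where "0 < \<delta>" "\<delta> < b / 2" "\<And>x. x \<in> {0..\<delta>} \<Longrightarrow> 0 < F x"
    "\<And>x. x \<in> {b - \<delta>..b} \<Longrightarrow> 0 < G x"
proof -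
  have "\<forall>\<^sub>F x in nhds 0. 0 < F x" "\<forall>\<^sub>F x in nhds b. 0 < G x"
    using assms by (auto simp: isCont_def intro: order_tendstoD simp: tendsto_at_iff_tendsto_nhds)
  then obtain e1 e2 where e: "0 < e1" "\<And>x. \<bar>x\<bar> < e1 \<Longrightarrow> 0 < F x"
    "0 < e2" "\<And>x. \<bar>x - b\<bar> < e2 \<Longrightarrow> 0 < G x"
    by (auto simp: eventually_nhds_metric dist_real_def)
  define \<delta> where "\<delta> = min (min e1 e2) b / 3"
  show ?thesis
    by (rule that[of \<delta>]) (use e assms in \<open>auto simp: \<delta>_def intro!: e(2,4)\<close>)
qed

locale two_zero_poly =
  fixes g h :: "real poly" and b :: real and d1 d2 :: nat
  assumes b_pos: "0 < b" and d1_pos: "d1 \<ge> 1" and d2_pos: "d2 \<ge> 1"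
    and factorisation: "g = [:0, 1:] ^ d1 * [:b, -1:] ^ d2 * h"
    and h_pos: "\<And>x. x \<in> {0..b} \<Longrightarrow> 0 < poly h x"
begin

lemma poly_g: "poly g x = x ^ d1 * (b - x) ^ d2 * poly h x"
  by (simp add: factorisation)

lemma poly_g_pos: "x \<in> {0<..<b} \<Longrightarrow> 0 < poly g x"
  using h_pos[of x] by (simp add: poly_g)

lemma poly_g_ends: "poly g 0 = 0" "poly g b = 0"
  using d1_pos d2_pos by (simp_all add: poly_g)

lemma poly_pderiv_g:
  "poly (pderiv g) x = real d1 * x ^ (d1 - 1) * (b - x) ^ d2 * poly h x
     - real d2 * x ^ d1 * (b - x) ^ (d2 - 1) * poly h x + x ^ d1 * (b - x) ^ d2 * poly (pderiv h) x"
proof (rule DERIV_unique[OF poly_DERIV])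
  have "poly g = (\<lambda>x. x ^ d1 * (b - x) ^ d2 * poly h x)"
    by (simp add: fun_eq_iff poly_g)
  then show "(poly g has_real_derivative real d1 * x ^ (d1 - 1) * (b - x) ^ d2 * poly h x
     - real d2 * x ^ d1 * (b - x) ^ (d2 - 1) * poly h x + x ^ d1 * (b - x) ^ d2 * poly (pderiv h) x) (at x)"
    by (auto intro!: derivative_eq_intros simp: algebra_simps)
qed

text \<open>This is \<open>x g'(x)/g(x)\<close> multiplied by \<open>(b - x) h(x)\<close>, which clears the denominators of the logarithmic
  derivative \<open>d\<^sub>1/x - d\<^sub>2/(b - x) + h'(x)/h(x)\<close>. It is thus continuous up to both end points.\<close>
definition log_slope :: "real \<Rightarrow> real" where
  "log_slope x = real d1 * (b - x) * poly h x - real d2 * x * poly h x + x * (b - x) * poly (pderiv h) x"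

lemma log_derivative:
  "x * (b - x) * poly h x * poly (pderiv g) x = poly g x * log_slope x"
proof -
  obtain m n where "d1 = Suc m" "d2 = Suc n"
    using d1_pos d2_pos by (cases d1; cases d2) auto
  then show ?thesis
    unfolding log_slope_def by (simp add: poly_g poly_pderiv_g algebra_simps)
qed

lemma poly_middle:
  assumes "0 < \<delta>" "\<delta> < b / 2"
  obtains N where "0 < N" "\<And>a x. N < a \<Longrightarrow> x \<in> {\<delta>..b - \<delta>} \<Longrightarrow> b < a * poly g x"
proof -
  obtain x\<^sub>0 where x0: "x\<^sub>0 \<in> {\<delta>..b - \<delta>}" "\<And>x. x \<in> {\<delta>..b - \<delta>} \<Longrightarrow> poly g x\<^sub>0 \<le> poly g x"
  proof -
    have "\<exists>x\<^sub>0\<in>{\<delta>..b - \<delta>}. \<forall>x\<in>{\<delta>..b - \<delta>}. poly g x\<^sub>0 \<le> poly g x"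
      using assms by (intro continuous_attains_inf continuous_intros) auto
    then show ?thesis using that by blast
  qed
  have m: "0 < poly g x\<^sub>0" using x0 assms by (intro poly_g_pos) auto
  show ?thesis
  proof (rule that)
    show "0 < b / poly g x\<^sub>0" using m b_pos by simp
    fix a x assume a: "b / poly g x\<^sub>0 < a" and x: "x \<in> {\<delta>..b - \<delta>}"
    have "0 < a" using a m b_pos by (meson divide_pos_pos less_trans)
    have "b < a * poly g x\<^sub>0" using a m by (simp add: divide_less_eq)
    also have "\<dots> \<le> a * poly g x" using x0(2)[OF x] \<open>0 < a\<close> by simp
    finally show "b < a * poly g x" .
  qed
qed

lemma family_deriv: "(poly_family g a has_real_derivative a * poly (pderiv g) x) (at x)"
  unfolding poly_family_def by (intro DERIV_cmult poly_DERIV)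

lemma family_deriv_cont: "continuous_on UNIV (\<lambda>x. a * poly (pderiv g) x)"
  by (intro continuous_intros)

text \<open>With denominators cleared, both estimates become strict inequalities between continuous functions at
  an end point. At \<open>0\<close> the inequality is \<open>d\<^sub>1 > 3/2\<close>; at \<open>b\<close> it is \<open>d\<^sub>2 b h(b) > 0\<close>.\<close>
lemma end_slopes:
  assumes "d1 \<ge> 2"
  obtains \<delta> where "0 < \<delta>" "\<delta> < b / 2"
    "\<And>x. x \<in> {0<..\<delta>} \<Longrightarrow> 3/2 * poly g x \<le> x * poly (pderiv g) x"
    "\<And>x. x \<in> {b - \<delta>..<b} \<Longrightarrow> 3/2 * poly g x \<le> - (x * poly (pderiv g) x)"
proof -
  define F where "F x = log_slope x - 3/2 * ((b - x) * poly h x)" for x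
  define G where "G x = - log_slope x - 3/2 * ((b - x) * poly h x)" for x
  have "0 < (real d1 - 3/2) * (b * poly h 0)"
    using assms b_pos h_pos[of 0] by (intro mult_pos_pos) auto
  then have F0: "0 < F 0" by (simp add: F_def log_slope_def algebra_simps)
  have Gb: "0 < G b" using d2_pos b_pos h_pos[of b] by (simp add: G_def log_slope_def)
  have "isCont F x" "isCont G x" for x
    unfolding F_def G_def log_slope_def by (intro continuous_intros)+
  then obtain \<delta> where \<delta>: "0 < \<delta>" "\<delta> < b / 2" "\<And>x. x \<in> {0..\<delta>} \<Longrightarrow> 0 < F x"
    "\<And>x. x \<in> {b - \<delta>..b} \<Longrightarrow> 0 < G x"
    using positive_near_ends[of F b G] F0 Gb b_pos by metis
  \<comment> \<open>The sign \<open>s\<close> is \<open>1\<close> at the left end and \<open>-1\<close> at the right end.\<close>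
  have scaled: "3/2 * poly g x \<le> s * (x * poly (pderiv g) x)"
    if x: "x \<in> {0<..<b}" and s: "3/2 * ((b - x) * poly h x) \<le> s * log_slope x" for x s
  proof -
    have p: "0 < (b - x) * poly h x" using x h_pos[of x] by simp
    have "(3/2 * poly g x) * ((b - x) * poly h x) = poly g x * (3/2 * ((b - x) * poly h x))"
      by simp
    also have "\<dots> \<le> poly g x * (s * log_slope x)"
      using s poly_g_pos[OF x] by (intro mult_left_mono) auto
    also have "\<dots> = (s * (x * poly (pderiv g) x)) * ((b - x) * poly h x)"
      using log_derivative[of x] by (simp add: algebra_simps)
    finally show ?thesis using p by (simp only: mult_le_cancel_right_pos)
  qed
  show ?thesis
  proof (rule that[OF \<delta>(1,2)])
    show "3/2 * poly g x \<le> x * poly (pderiv g) x" if "x \<in> {0<..\<delta>}" for x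
      using scaled[of x 1] \<delta>(3)[of x] \<delta>(2) b_pos that by (simp add: F_def)
    show "3/2 * poly g x \<le> - (x * poly (pderiv g) x)" if "x \<in> {b - \<delta>..<b}" for x
      using scaled[of x "-1"] \<delta>(4)[of x] \<delta>(2) b_pos that by (simp add: G_def)
  qed
qed

text \<open>Multiplying by \<open>a\<close> does not change the slopes in the metric \<open>dx/x\<close>; it only has to raise the middle
  part of the graph above \<open>b\<close>.\<close>
lemma horseshoe_multiple_zero:
  assumes "d1 \<ge> 2"
  shows "\<exists>N>0. \<forall>a>N. \<exists>L. is_horseshoe (poly_family g a) L \<and>
    (\<forall>x\<in>{0<..<b} - L. (\<exists>k\<ge>1. (poly_family g a ^^ k) x \<notin> {0..b}) \<or>
      (\<lambda>k. (poly_family g a ^^ k) x) \<longlonglongrightarrow> 0)"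
proof -
  obtain \<delta> where \<delta>: "0 < \<delta>" "\<delta> < b / 2"
    and left: "\<And>x. x \<in> {0<..\<delta>} \<Longrightarrow> 3/2 * poly g x \<le> x * poly (pderiv g) x"
    and right: "\<And>x. x \<in> {b - \<delta>..<b} \<Longrightarrow> 3/2 * poly g x \<le> - (x * poly (pderiv g) x)"
    by (rule end_slopes[OF assms]) blast
  obtain N where N: "0 < N" "\<And>a x. N < a \<Longrightarrow> x \<in> {\<delta>..b - \<delta>} \<Longrightarrow> b < a * poly g x"
    by (rule poly_middle[OF \<delta>]) blast
  have "poly (pderiv g) 0 = 0"
    using assms by (simp add: poly_pderiv_g power_0_left)
  then have "\<exists>L. is_horseshoe (poly_family g a) L \<and>
    (\<forall>x\<in>{0<..<b} - L. (\<exists>k\<ge>1. (poly_family g a ^^ k) x \<notin> {0..b}) \<or>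
      (\<lambda>k. (poly_family g a ^^ k) x) \<longlonglongrightarrow> 0)" if a: "N < a" for a
  proof (intro horseshoe_superattracting[OF family_deriv family_deriv_cont _ _ _ _ \<delta>])
    fix x
    show "3/2 * poly_family g a x \<le> x * (a * poly (pderiv g) x)" if "x \<in> {0<..\<delta>}"
      using mult_left_mono[OF left[OF that], of a] a N by (simp add: poly_family_def algebra_simps)
    show "3/2 * poly_family g a x \<le> - (x * (a * poly (pderiv g) x))" if "x \<in> {b - \<delta>..<b}"
      using mult_left_mono[OF right[OF that], of a] a N by (simp add: poly_family_def algebra_simps)
  qed (use a N poly_g_pos poly_g_ends in \<open>auto simp: poly_family_def\<close>)
  with N show ?thesis by blast
qed

text \<open>At simple zeros the slopes of \<open>g\<close> are nonzero, and a large factor makes them steep.\<close>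
lemma horseshoe_simple_zeros:
  assumes d: "d1 = 1" "d2 = 1"
  shows "\<exists>N>0. \<forall>a>N. is_horseshoe (poly_family g a) {x. \<forall>k. (poly_family g a ^^ k) x \<in> {0..b}}"
proof -
  let ?p = "poly (pderiv g)"
  have ends: "?p 0 = b * poly h 0" "?p b = - (b * poly h b)"
    by (simp_all add: poly_pderiv_g d)
  \<comment> \<open>Half the smaller end slope still bounds the slopes near the ends.\<close>
  define \<epsilon> where "\<epsilon> = min (b * poly h 0) (b * poly h b) / 2"
  have e: "0 < \<epsilon>" "\<epsilon> < ?p 0" "\<epsilon> < - ?p b"
    using b_pos h_pos[of 0] h_pos[of b] by (auto simp: \<epsilon>_def ends min_def)
  obtain \<delta> where \<delta>: "0 < \<delta>" "\<delta> < b / 2"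
    and left: "\<And>x. x \<in> {0..\<delta>} \<Longrightarrow> 0 < ?p x - \<epsilon>"
    and right: "\<And>x. x \<in> {b - \<delta>..b} \<Longrightarrow> 0 < - ?p x - \<epsilon>"
  proof -
    have cont: "isCont (\<lambda>x. ?p x - \<epsilon>) y" "isCont (\<lambda>x. - ?p x - \<epsilon>) y" for y
      by (intro continuous_intros)+
    have "0 < ?p 0 - \<epsilon>" "0 < - ?p b - \<epsilon>" using e by auto
    from positive_near_ends[OF cont(1) this(1) cont(2) this(2) b_pos] that
    show ?thesis by metis
  qed
  obtain N where N: "0 < N" "\<And>a x. N < a \<Longrightarrow> x \<in> {\<delta>..b - \<delta>} \<Longrightarrow> b < a * poly g x"
    by (rule poly_middle[OF \<delta>]) blast
  have "is_horseshoe (poly_family g a) {x. \<forall>k. (poly_family g a ^^ k) x \<in> {0..b}}"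
    if a: "max N (2 / \<epsilon>) < a" for a
  proof (rule horseshoe_simple_ends[OF family_deriv family_deriv_cont _ _ \<delta>])
    have a\<epsilon>: "2 < a * \<epsilon>" "0 < a" using a e N by (auto simp: divide_less_eq)
    fix x
    show "2 \<le> a * ?p x" if "x \<in> {0..\<delta>}"
    proof -
      have "a * \<epsilon> \<le> a * ?p x" using left[OF that] a\<epsilon> by (intro mult_left_mono) auto
      with a\<epsilon> show ?thesis by linarith
    qed
    show "a * ?p x \<le> - 2" if "x \<in> {b - \<delta>..b}"
    proof -
      have "a * \<epsilon> \<le> a * (- ?p x)" using right[OF that] a\<epsilon> by (intro mult_left_mono) auto
      also have "\<dots> = - (a * ?p x)" by simp
      finally show ?thesis using a\<epsilon> by linarith
    qed
  qed (use a N poly_g_ends in \<open>auto simp: poly_family_def\<close>)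
  with N show ?thesis by (intro exI[of _ "max N (2 / \<epsilon>)"]) auto
qed

lemma horseshoe_large_factor:
  assumes "d1 \<ge> 2 \<or> d1 = 1 \<and> d2 = 1"
  shows "\<exists>N>0. \<forall>a>N. \<exists>L. is_horseshoe (poly_family g a) L \<and>
    (d1 \<ge> 2 \<longrightarrow> (\<forall>x\<in>{0<..<b} - L. (\<exists>k\<ge>1. (poly_family g a ^^ k) x \<notin> {0..b}) \<or>
      (\<lambda>k. (poly_family g a ^^ k) x) \<longlonglongrightarrow> 0)) \<and>
    (d1 = 1 \<and> d2 = 1 \<longrightarrow> L = {x. \<forall>k. (poly_family g a ^^ k) x \<in> {0..b}})"
proof (cases "d1 \<ge> 2")
  case True
  then have "d1 \<noteq> 1" by simp
  with True show ?thesis using horseshoe_multiple_zero by (simp only: simp_thms)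
next
  case False
  with assms have d: "d1 = 1" "d2 = 1" by auto
  show ?thesis using horseshoe_simple_zeros[OF d] False d by (simp only: simp_thms) blast
qed

end

section \<open>The polynomial family\<close>

theorem theorem3p2:
  fixes g h :: "real poly" and b :: real and d1 d2 :: nat
  assumes "lead_coeff g = 1"
    and "order 0 g = d1" and "d1 \<ge> 1"
    and "b > 0" and "poly g b = 0" and "\<And>x. 0 < x \<Longrightarrow> x < b \<Longrightarrow> poly g x \<noteq> 0"
    and "order b g = d2" and "d2 \<ge> 1"
    and "g = [:0, 1:] ^ d1 * [:b, -1:] ^ d2 * h"
    and "\<And>x. x \<in> {0..b} \<Longrightarrow> poly h x \<noteq> 0"
    and "(d1 > d2 \<and> d2 \<ge> 2) \<or> (d1 > d2 \<and> d2 = 1) \<or> (d2 \<ge> d1 \<and> d1 > 1) \<or> (d1 = 1 \<and> d2 = 1)"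
  shows "\<exists>N>0. \<forall>a::real. \<bar>a\<bar> > N \<and> (\<forall>x\<in>{0..b}. a * poly h x > 0) \<longrightarrow>
    (\<exists>L. invariant_set (poly_family g a) L \<and> cantor_set L \<and>
      hyperbolic_on (poly_family g a) L \<and>
      top_conjugate (top_of_set L) (poly_family g a) Sigma2_top shift \<and>
      ((d1 > d2 \<and> d2 \<ge> 2) \<or> (d1 > d2 \<and> d2 = 1) \<or> (d2 \<ge> d1 \<and> d1 > 1) \<longrightarrow>
        (\<forall>x\<in>{0<..<b} - L.
          (\<exists>k\<ge>1. (poly_family g a ^^ k) x \<notin> {0..b}) \<or>
          (\<lambda>k. (poly_family g a ^^ k) x) \<longlonglongrightarrow> 0)) \<and>
      (d1 = 1 \<and> d2 = 1 \<longrightarrow>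
        L = {x. \<forall>k. (poly_family g a ^^ k) x \<in> {0..b}}))"
proof -
  let ?concl = "\<lambda>a L. is_horseshoe (poly_family g a) L \<and>
    (d1 \<ge> 2 \<longrightarrow> (\<forall>x\<in>{0<..<b} - L. (\<exists>k\<ge>1. (poly_family g a ^^ k) x \<notin> {0..b}) \<or>
      (\<lambda>k. (poly_family g a ^^ k) x) \<longlonglongrightarrow> 0)) \<and>
    (d1 = 1 \<and> d2 = 1 \<longrightarrow> L = {x. \<forall>k. (poly_family g a ^^ k) x \<in> {0..b}})"
  note cases = assms(11)
  have d: "d1 \<ge> 2 \<or> d1 = 1 \<and> d2 = 1" using cases by auto
  have "\<exists>N>0. \<forall>a. \<bar>a\<bar> > N \<and> (\<forall>x\<in>{0..b}. a * poly h x > 0) \<longrightarrow> (\<exists>L. ?concl a L)"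
  proof -
    \<comment> \<open>The bound has to be chosen before the sign of \<open>a\<close> is known. A negative \<open>h\<close> is treated by passing to
      \<open>- g\<close> and \<open>- a\<close>; without a constant sign of \<open>h\<close> no \<open>a\<close> is admissible.\<close>
    consider (pos) "\<forall>x\<in>{0..b}. 0 < poly h x" | (neg) "\<forall>x\<in>{0..b}. 0 < poly (- h) x"
      | (mixed) "\<not> (\<forall>x\<in>{0..b}. 0 < poly h x)" "\<not> (\<forall>x\<in>{0..b}. 0 < poly (- h) x)" by blast
    then show ?thesis
    proof cases
      case pos
      interpret two_zero_poly g h b d1 d2
        by unfold_locales (use assms(3,4,8,9) pos in auto)
      obtain N where N: "N > 0" "\<forall>a>N. \<exists>L. ?concl a L"
        using horseshoe_large_factor[OF d] by blast
      show ?thesis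
      proof (intro exI[of _ N] conjI allI impI N(1))
        fix a assume a: "\<bar>a\<bar> > N \<and> (\<forall>x\<in>{0..b}. a * poly h x > 0)"
        have "0 < poly h 0" "0 < a * poly h 0" using pos a \<open>b > 0\<close> by auto
        then have "0 < a" by (simp add: zero_less_mult_iff)
        with a have "a > N" by simp
        then show "\<exists>L. ?concl a L" by (rule N(2)[rule_format])
      qed
    next
      case neg
      interpret two_zero_poly "- g" "- h" b d1 d2
        by unfold_locales (use assms(3,4,8,9) neg in auto)
      have flip: "poly_family (- g) (- a) = poly_family g a" for a
        by (simp add: poly_family_def)
      obtain N where N: "N > 0" "\<forall>a>N. \<exists>L. ?concl (- a) L"
        using horseshoe_large_factor[OF d] flip[of "- a" for a] by auto
      show ?thesis
      proof (intro exI[of _ N] conjI allI impI N(1))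
        fix a assume a: "\<bar>a\<bar> > N \<and> (\<forall>x\<in>{0..b}. a * poly h x > 0)"
        have "poly h 0 < 0" "0 < a * poly h 0" using neg a \<open>b > 0\<close> by auto
        then have "a < 0" by (simp add: zero_less_mult_iff)
        with a have "- a > N" by simp
        then show "\<exists>L. ?concl a L"
          using N(2)[rule_format, of "- a"] by (simp only: minus_minus)
      qed
    next
      case mixed
      have False if "\<forall>x\<in>{0..b}. a * poly h x > 0" for a
      proof (cases "a > 0")
        case True
        then show False using that mixed(1) by (auto simp: zero_less_mult_iff)
      next
        case False
        then show False using that mixed(2) by (auto simp: zero_less_mult_iff)
      qed
      then show ?thesis by (intro exI[of _ 1]) auto
    qed
  qed
  moreover have "(d1 > d2 \<and> d2 \<ge> 2) \<or> (d1 > d2 \<and> d2 = 1) \<or> (d2 \<ge> d1 \<and> d1 > 1) \<longleftrightarrow> d1 \<ge> 2"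
    using cases by auto
  ultimately show ?thesis
    by (simp only: is_horseshoe_def conj_assoc)
qed

end
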